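(* Let $H$ be any finite simple undirected graph on $V=[n]$, let $\mathbf x_1,\dots,\mathbf x_n\in\mathbb R^d$, and let $\lambda>0$. Let $F_H$ and $F_{H,\lambda}$ be the functions defined by the recurrences in the context. For $S\subseteq V$ and an integer $k\ge 0$, let $\mathcal P_{H,k}(S)$ be the set of partitions of $S$ into exactly $k$ nonempty blocks $A$ each of which induces a connected subgraph $H[A]$ (with the empty partition as the unique element for $(S,k)=(\emptyset,0)$). Then for every $S\subseteq V$ and every integer $k\ge 0$, $$F_H(S,k)=\min_{\ell\in\mathcal P_{H,k}(S)}\sum_{A\in\ell}\phi_{\mathrm{SSE}}(A),$$ $$F_{H,\lambda}(S)=\min_{\ell\in\bigcup_{k=0}^{|S|}\mathcal P_{H,k}(S)}\ \sum_{A\in\ell}\{\phi_{\mathrm{SSE}}(A)+\lambda\}.$$ In particular, $F_H(V,K)=\mathrm{OPT}(H,K)$ for $1\le K\le n$, where $\mathrm{OPT}(H,K)$ is the minimum of $\sum_{A\in\ell}\phi_{\mathrm{SSE}}(A)$ over all partitions $\ell$ of $V$ into exactly $K$ nonempty blocks, each inducing a connected subgraph of $H$.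
   Context: $V=[n]=\{1,\dots,n\}$ indexes the observations (indices are distinct even if coordinates coincide). For nonempty $A\subseteq V$, $\phi_{\mathrm{SSE}}(A)=\sum_{i\in A}\|\mathbf x_i-\boldsymbol\mu(A)\|^2$ with $\boldsymbol\mu(A)=|A|^{-1}\sum_{i\in A}\mathbf x_i$. Convention: $\min\emptyset=+\infty$. $\mathcal C(H)=\{A\subseteq V: A\neq\emptyset,\ H[A]\text{ is connected}\}$, where $H[A]$ is the induced subgraph. For nonempty $S\subseteq V$ and $1\le k\le|S|$ put $\mathcal A_H(S,k)=\{B\in\mathcal C(H): B\subseteq S,\ \min S\in B,\ |B|\le|S|-k+1\}$ and $\mathcal A_{H,\lambda}(S)=\{B\in\mathcal C(H):B\subseteq S,\ \min S\in B\}$. Fixed-count recurrence: $F_H(\emptyset,0)=0$; $F_H(S,k)=+\infty$ if $k=0<|S|$ or $k>|S|$; and for $S\ne\emptyset$, $1\le k\le|S|$, $$F_H(S,k)=\min_{B\in\mathcal A_H(S,k)}\{\phi_{\mathrm{SSE}}(B)+F_H(S\setminus B,k-1)\}.$$ Penalized recurrence: $F_{H,\lambda}(\emptyset)=0$ and for $S\neq\emptyset$, $$F_{H,\lambda}(S)=\min_{B\in\mathcal A_{H,\lambda}(S)}\{\phi_{\mathrm{SSE}}(B)+\lambda+F_{H,\lambda}(S\setminus B)\}.$$ *)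

theory Defs
  imports
    "HOL-Analysis.Analysis"
    "HOL-Library.Extended_Real"
    "HOL-Library.Disjoint_Sets"
    "Graph_Theory.Digraph_Component"
begin

text \<open>
  A finite simple undirected graph is a \<^locale>\<open>pair_graph\<close>: a finite, loop-free, symmetric
  digraph without parallel arcs. The name \<open>connected\<close> is also used for topological connectedness,
  so graph connectedness is always written \<open>Digraph_Component.connected\<close>.
\<close>

text \<open>
  Minimum with the convention that the minimum of the empty set is \<open>\<infinity>\<close>. It is only
  meaningful for finite sets; \<open>finite_fixed_blocks\<close>, \<open>finite_penalized_blocks\<close> and
  \<open>finite_connected_partitions\<close> below show that it is only used for finite sets.
\<close>
definition ext_min :: "ereal set \<Rightarrow> ereal" where
  "ext_min X = (if X = {} then \<infinity> else Min X)"

definition centroid :: "(nat \<Rightarrow> real ^ 'd) \<Rightarrow> nat set \<Rightarrow> real ^ 'd" where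
  "centroid x A = (1 / real (card A)) *\<^sub>R (\<Sum>i\<in>A. x i)"

definition sse :: "(nat \<Rightarrow> real ^ 'd) \<Rightarrow> nat set \<Rightarrow> real" where
  "sse x A = (\<Sum>i\<in>A. (norm (x i - centroid x A))\<^sup>2)"

definition connected_sets :: "nat pair_pre_digraph \<Rightarrow> nat set set" where
  "connected_sets H =
     {A. A \<subseteq> pverts H \<and> A \<noteq> {} \<and> Digraph_Component.connected (with_proj H \<restriction> A)}"

definition fixed_blocks :: "nat pair_pre_digraph \<Rightarrow> nat set \<Rightarrow> nat \<Rightarrow> nat set set" where
  "fixed_blocks H S k = {B \<in> connected_sets H. B \<subseteq> S \<and> Min S \<in> B \<and> card B \<le> card S - k + 1}"

definition penalized_blocks :: "nat pair_pre_digraph \<Rightarrow> nat set \<Rightarrow> nat set set" where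
  "penalized_blocks H S = {B \<in> connected_sets H. B \<subseteq> S \<and> Min S \<in> B}"

primrec fixed_count :: "nat pair_pre_digraph \<Rightarrow> (nat \<Rightarrow> real ^ 'd) \<Rightarrow> nat set \<Rightarrow> nat \<Rightarrow> ereal" where
  "fixed_count H x S 0 = (if S = {} then 0 else \<infinity>)"
| "fixed_count H x S (Suc k) =
     (if Suc k > card S then \<infinity>
      else ext_min ((\<lambda>B. ereal (sse x B) + fixed_count H x (S - B) k) ` fixed_blocks H S (Suc k)))"

text \<open>
  The value at infinite \<open>S\<close> is a dummy that makes the recursion terminate; every \<open>S\<close>
  of interest is a subset of a finite vertex set.
\<close>
function penalized ::
  "nat pair_pre_digraph \<Rightarrow> (nat \<Rightarrow> real ^ 'd) \<Rightarrow> real \<Rightarrow> nat set \<Rightarrow> ereal" where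
  "penalized H x lam S =
     (if S = {} then 0
      else if finite S then
        ext_min ((\<lambda>B. ereal (sse x B) + ereal lam + penalized H x lam (S - B)) ` penalized_blocks H S)
      else \<infinity>)"
  by pat_completeness auto
termination
proof (relation "Wellfounded.measure (\<lambda>(H, x, lam, S). card S)", goal_cases)
  case (2 H x lam S B)
  then have "B \<subseteq> S" "B \<noteq> {}"
    by (auto simp: penalized_blocks_def)
  with 2 have "S - B \<subset> S"
    by blast
  with 2 show ?case
    by (simp add: psubset_card_mono)
qed simp

declare penalized.simps [simp del]

definition connected_partitions :: "nat pair_pre_digraph \<Rightarrow> nat \<Rightarrow> nat set \<Rightarrow> nat set set set" where
  "connected_partitions H k S =
     {P. partition_on S P \<and> card P = k \<and>
         (\<forall>A\<in>P. Digraph_Component.connected (with_proj H \<restriction> A))}"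

definition OPT :: "nat pair_pre_digraph \<Rightarrow> (nat \<Rightarrow> real ^ 'd) \<Rightarrow> nat \<Rightarrow> ereal" where
  "OPT H x K =
     ext_min ((\<lambda>P. \<Sum>A\<in>P. ereal (sse x A)) ` connected_partitions H K (pverts H))"

lemma finite_fixed_blocks: "finite S \<Longrightarrow> finite (fixed_blocks H S k)"
  by (rule finite_subset[of _ "Pow S"]) (auto simp: fixed_blocks_def)

lemma finite_penalized_blocks: "finite S \<Longrightarrow> finite (penalized_blocks H S)"
  by (rule finite_subset[of _ "Pow S"]) (auto simp: penalized_blocks_def)

lemma finite_connected_partitions: "finite S \<Longrightarrow> finite (connected_partitions H k S)"
  by (rule finite_subset[OF _ finitely_many_partition_on]) (auto simp: connected_partitions_def)

lemma connected_partitions_empty: "connected_partitions H 0 {} = {{}}"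
  by (auto simp: connected_partitions_def partition_on_def)

lemma fixed_count_empty: "fixed_count H x {} 0 = 0"
  by simp

lemma fixed_count_infinite:
  assumes "(k = 0 \<and> card S > 0) \<or> k > card S"
  shows "fixed_count H x S k = \<infinity>"
  using assms by (cases k) auto

lemma fixed_count_rec:
  assumes "1 \<le> k" "k \<le> card S"
  shows "fixed_count H x S k =
    ext_min ((\<lambda>B. ereal (sse x B) + fixed_count H x (S - B) (k - 1)) ` fixed_blocks H S k)"
  using assms by (cases k) auto

lemma penalized_empty: "penalized H x lam {} = 0"
  by (simp add: penalized.simps)

lemma penalized_rec:
  assumes "finite S" "S \<noteq> {}"
  shows "penalized H x lam S =
    ext_min ((\<lambda>B. ereal (sse x B) + ereal lam + penalized H x lam (S - B)) ` penalized_blocks H S)"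
  using assms by (subst penalized.simps) simp

end

theory Submission
  imports Defs
begin

text \<open>
  A partition of a nonempty \<open>S\<close> has exactly one block containing \<open>Min S\<close>. Removing that block
  is a bijection onto pairs of an admissible block \<open>B\<close> and a partition of \<open>S - B\<close>, so the
  minimum over partitions satisfies the same recurrences. The size bound in the fixed-count
  recurrence discards only those \<open>B\<close> for which \<open>S - B\<close> is too small to have a partition
  into \<open>k - 1\<close> blocks.
\<close>

text \<open>In \<open>ereal\<close> the infimum of the empty set is the top element, which is
  exactly the convention for an empty minimum. Minima over finite sets can thus be handled by the
  lattice rules for \<open>INF\<close>, with no case split on emptiness.\<close>

lemma ext_min_eq_Inf:
  assumes "finite X"
  shows "ext_min X = Inf X"
  using assms by (auto simp: ext_min_def Min_Inf top_ereal_def)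

text \<open>The constant is a finite real, so it can be subtracted again from a lower bound. An
  empty \<open>X\<close> is covered, since adding a real to infinity gives infinity.\<close>

lemma ereal_add_Inf: "ereal c + Inf X = (INF x\<in>X. ereal c + x)"
proof (rule antisym)
  show "ereal c + Inf X \<le> (INF x\<in>X. ereal c + x)"
    by (intro INF_greatest add_left_mono Inf_lower)
  have "(INF x\<in>X. ereal c + x) - ereal c \<le> x" if "x \<in> X" for x
    using INF_lower[OF that, of "\<lambda>x. ereal c + x"] by (simp add: ereal_minus_le add.commute)
  then have "(INF x\<in>X. ereal c + x) - ereal c \<le> Inf X"
    by (rule Inf_greatest)
  then show "(INF x\<in>X. ereal c + x) \<le> ereal c + Inf X"
    by (simp add: ereal_minus_le add.commute)
qed

text \<open>The common core of both recurrences: a minimum over a union is a minimum of minima, and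
  \<open>B \<notin> P\<close> lets the weight of \<open>B\<close> split off the sum. The weight
  \<open>w\<close> is arbitrary so that it can be the block error with or without the penalty. A
  \<open>B\<close> with empty \<open>\<P> B\<close> gives no partition on the left and the value
  infinity on the right.\<close>

lemma ext_min_sum_insert:
  assumes "finite \<B>"
    and "\<And>B. B \<in> \<B> \<Longrightarrow> finite (\<P> B)"
    and "\<And>B P. B \<in> \<B> \<Longrightarrow> P \<in> \<P> B \<Longrightarrow> finite P \<and> B \<notin> P"
  shows "ext_min ((\<lambda>P. \<Sum>A\<in>P. ereal (w A)) ` (\<Union>B\<in>\<B>. insert B ` \<P> B)) =
    ext_min ((\<lambda>B. ereal (w B) + ext_min ((\<lambda>P. \<Sum>A\<in>P. ereal (w A)) ` \<P> B)) ` \<B>)"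
proof -
  have "(INF P\<in>insert B ` \<P> B. \<Sum>A\<in>P. ereal (w A)) =
      ereal (w B) + ext_min ((\<lambda>P. \<Sum>A\<in>P. ereal (w A)) ` \<P> B)" if "B \<in> \<B>" for B
  proof -
    have "(INF P\<in>insert B ` \<P> B. \<Sum>A\<in>P. ereal (w A)) =
        (INF P\<in>\<P> B. ereal (w B) + (\<Sum>A\<in>P. ereal (w A)))"
      \<comment> \<open>Simplification by \<open>sum_ereal\<close> would pull \<open>ereal\<close>
        out of the sums and destroy their common shape.\<close>
      unfolding image_image using assms(3)[OF that] by (intro INF_cong) (auto simp del: sum_ereal)
    also have "\<dots> = ereal (w B) + ext_min ((\<lambda>P. \<Sum>A\<in>P. ereal (w A)) ` \<P> B)"
      using assms(2)[OF that]
      by (simp add: ext_min_eq_Inf ereal_add_Inf image_image del: sum_ereal)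
    finally show ?thesis .
  qed
  moreover have "(INF P\<in>(\<Union>B\<in>\<B>. insert B ` \<P> B). \<Sum>A\<in>P. ereal (w A)) =
      (INF B\<in>\<B>. INF P\<in>insert B ` \<P> B. \<Sum>A\<in>P. ereal (w A))"
    by (rule order_antisym; blast intro: INF_greatest INF_lower2)
  ultimately show ?thesis
    using assms(1,2) by (simp add: ext_min_eq_Inf del: sum_ereal cong: INF_cong)
qed

lemma card_partition_on_le:
  assumes "finite S" "partition_on S P"
  shows "card P \<le> card S"
proof -
  have "card P = (\<Sum>A\<in>P. 1)" by simp
  also have "\<dots> \<le> (\<Sum>A\<in>P. card A)"
    using assms by (intro sum_mono)
      (metis One_nat_def Suc_leI card_gt_0_iff partition_onD1 partition_onD3 Sup_upper finite_subset)
  also have "\<dots> = card S"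
    using assms product_partition by (metis partition_onD1 Sup_upper finite_subset)
  finally show ?thesis .
qed

text \<open>\<open>S \<subseteq> pverts H\<close> is what puts blocks into
  \<open>connected_sets\<close>, since \<open>connected_partitions\<close> itself does not mention
  the vertex set.\<close>

lemma connected_partitions_Suc:
  assumes "finite S" "S \<noteq> {}" "S \<subseteq> pverts H"
  shows "connected_partitions H (Suc k) S =
    (\<Union>B\<in>penalized_blocks H S. insert B ` connected_partitions H k (S - B))" (is "?L = ?R")
proof (intro equalityI subsetI)
  fix P assume P: "P \<in> ?L"
  then have part: "partition_on S P" by (simp add: connected_partitions_def)
  then have "Min S \<in> \<Union>P" using assms Min_in by (metis partition_onD1)
  then obtain B where B: "B \<in> P" "Min S \<in> B" by blast
  have BS: "B \<subseteq> S" using B part by (auto simp: partition_on_def)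
  \<comment> \<open>This is the side condition under which \<open>partition_on_insert\<close> strips
    off \<open>B\<close>.\<close>
  have "disjnt B (\<Union>(P - {B}))"
    using part B by (fastforce simp: partition_on_def disjoint_def disjnt_def)
  then have "partition_on (S - B) (P - {B})"
    using part B(1) partition_on_insert[of B "P - {B}" S] by (simp add: insert_absorb)
  then have "P - {B} \<in> connected_partitions H k (S - B)"
    using P B by (auto simp: connected_partitions_def)
  moreover have "B \<in> penalized_blocks H S"
    using P B BS assms by (auto simp: penalized_blocks_def connected_sets_def connected_partitions_def)
  ultimately show "P \<in> ?R" using B by (metis UN_I image_eqI insert_Diff)
next
  fix P assume "P \<in> ?R"
  then obtain B Q where B: "B \<in> penalized_blocks H S"
    and Q: "Q \<in> connected_partitions H k (S - B)" and P: "P = insert B Q"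
    by blast
  have B': "B \<subseteq> S" "B \<noteq> {}" using B by (auto simp: penalized_blocks_def connected_sets_def)
  have part: "partition_on (S - B) Q" using Q by (simp add: connected_partitions_def)
  \<comment> \<open>Members of \<open>Q\<close> lie in \<open>S - B\<close> while \<open>B\<close>
    is nonempty; hence inserting \<open>B\<close> raises the cardinality by exactly one.\<close>
  then have "B \<notin> Q" using B' by (auto simp: partition_on_def)
  moreover have "finite Q" using part assms finite_elements by blast
  moreover have "partition_on S P"
    using part B' P partition_on_insert[of B Q S] by (auto simp: partition_on_def disjnt_def)
  ultimately show "P \<in> ?L"
    using B Q P
    by (auto simp: connected_partitions_def penalized_blocks_def connected_sets_def)
qed

lemma connected_partitions_Suc_fixed:
  assumes "finite S" "S \<noteq> {}" "S \<subseteq> pverts H"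
  shows "connected_partitions H (Suc k) S =
    (\<Union>B\<in>fixed_blocks H S (Suc k). insert B ` connected_partitions H k (S - B))"
proof -
  have "B \<in> fixed_blocks H S (Suc k)"
    if B: "B \<in> penalized_blocks H S" and P: "P \<in> connected_partitions H k (S - B)" for B P
  proof -
    have BS: "B \<subseteq> S" "B \<noteq> {}" using B by (auto simp: penalized_blocks_def connected_sets_def)
    have "k \<le> card (S - B)"
      using P assms card_partition_on_le[of "S - B" P] by (auto simp: connected_partitions_def)
    also have "\<dots> = card S - card B" using BS assms by (metis card_Diff_subset finite_subset)
    finally have "k \<le> card S - card B" .
    \<comment> \<open>With \<open>k \<le> card S - card B\<close> these give
      \<open>Suc k \<le> card S\<close>, so the truncated subtractions on \<open>nat\<close> are
      exact.\<close>
    moreover have "0 < card B" "card B \<le> card S"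
      using BS assms by (auto simp: card_gt_0_iff card_mono finite_subset)
    ultimately have "card B \<le> card S - Suc k + 1" by linarith
    then show ?thesis using B by (auto simp: penalized_blocks_def fixed_blocks_def)
  qed
  moreover have "fixed_blocks H S (Suc k) \<subseteq> penalized_blocks H S"
    by (auto simp: penalized_blocks_def fixed_blocks_def)
  ultimately show ?thesis
    unfolding connected_partitions_Suc[OF assms] by blast
qed

lemma penalized_block_notin_partition:
  assumes "finite S" "B \<in> penalized_blocks H S" "P \<in> connected_partitions H k (S - B)"
  shows "finite P \<and> B \<notin> P"
proof
  have part: "partition_on (S - B) P" using assms by (simp add: connected_partitions_def)
  then show "finite P" using assms finite_elements by blast
  show "B \<notin> P"
    using part assms by (auto simp: partition_on_def penalized_blocks_def connected_sets_def)
qed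

text \<open>An infinite family also has \<open>card\<close> equal to 0; finiteness of
  \<open>S\<close> rules this out.\<close>

lemma connected_partitions_0:
  assumes "finite S"
  shows "connected_partitions H 0 S = (if S = {} then {{}} else {})"
proof -
  have "P = {}" "S = {}" if "P \<in> connected_partitions H 0 S" for P
  proof -
    have part: "partition_on S P" and "card P = 0"
      using that by (simp_all add: connected_partitions_def)
    then show "P = {}" using finite_elements[OF assms part] by simp
    with part show "S = {}" by (simp add: partition_on_def)
  qed
  then show ?thesis
    by (auto simp: connected_partitions_empty)
qed

lemma connected_partitions_card_less:
  assumes "finite S" "card S < k"
  shows "connected_partitions H k S = {}"
  using assms card_partition_on_le by (fastforce simp: connected_partitions_def)

text \<open>Induction on \<open>k\<close> for all \<open>S\<close> at once, because the recurrence
  passes from \<open>S\<close> to \<open>S - B\<close>.\<close>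

lemma fixed_count_eq:
  assumes "finite S" "S \<subseteq> pverts H"
  shows "fixed_count H x S k =
    ext_min ((\<lambda>P. \<Sum>A\<in>P. ereal (sse x A)) ` connected_partitions H k S)"
  using assms
proof (induction k arbitrary: S)
  case 0
  then show ?case by (simp add: connected_partitions_0 ext_min_def)
next
  case (Suc k)
  show ?case
  proof (cases "Suc k \<le> card S")
    case True
    then have "S \<noteq> {}" by auto
    have "fixed_count H x S (Suc k) =
        ext_min ((\<lambda>B. ereal (sse x B) + fixed_count H x (S - B) k) ` fixed_blocks H S (Suc k))"
      using True by simp
    also have "\<dots> = ext_min ((\<lambda>B. ereal (sse x B) +
        ext_min ((\<lambda>P. \<Sum>A\<in>P. ereal (sse x A)) ` connected_partitions H k (S - B))) `
          fixed_blocks H S (Suc k))"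
      using Suc.prems by (subst Suc.IH) auto
    also have "\<dots> = ext_min ((\<lambda>P. \<Sum>A\<in>P. ereal (sse x A)) ` connected_partitions H (Suc k) S)"
      unfolding connected_partitions_Suc_fixed[OF Suc.prems(1) \<open>S \<noteq> {}\<close> Suc.prems(2)]
    proof (rule ext_min_sum_insert[symmetric])
      fix B P assume "B \<in> fixed_blocks H S (Suc k)" "P \<in> connected_partitions H k (S - B)"
      moreover from this have "B \<in> penalized_blocks H S"
        by (simp add: fixed_blocks_def penalized_blocks_def)
      ultimately show "finite P \<and> B \<notin> P"
        using Suc.prems penalized_block_notin_partition by blast
    qed (use Suc.prems finite_fixed_blocks finite_connected_partitions in auto)
    finally show ?thesis .
  next
    \<comment> \<open>Too few elements for \<open>Suc k\<close> blocks: there is no partition, and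
      both sides are infinity.\<close>
    case False
    then show ?thesis
      using Suc.prems by (simp add: connected_partitions_card_less ext_min_def)
  qed
qed

text \<open>The bound \<open>card S\<close> would change along the recursion, so the induction uses
  the union over all \<open>k\<close>; the bounded form returns for finiteness and for the final
  statement.\<close>

lemma UN_connected_partitions:
  assumes "finite S" "card S \<le> m"
  shows "(\<Union>k\<in>{0..m}. connected_partitions H k S) = (\<Union>k. connected_partitions H k S)"
  using assms connected_partitions_card_less[OF assms(1)] by (force simp: not_le[symmetric])

lemma UN_connected_partitions_rec:
  assumes "finite S" "S \<noteq> {}" "S \<subseteq> pverts H"
  shows "(\<Union>k. connected_partitions H k S) =
    (\<Union>B\<in>penalized_blocks H S. insert B ` (\<Union>k. connected_partitions H k (S - B)))"
proof -
  have "(\<Union>k. connected_partitions H k S) = (\<Union>k. connected_partitions H (Suc k) S)"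
  proof (intro equalityI subsetI)
    fix P assume "P \<in> (\<Union>k. connected_partitions H k S)"
    then obtain k where "P \<in> connected_partitions H k S" by blast
    then show "P \<in> (\<Union>k. connected_partitions H (Suc k) S)"
      \<comment> \<open>A nonempty \<open>S\<close> has no partition into 0 blocks, so the index may
        be shifted.\<close>
      using assms by (cases k) (auto simp: connected_partitions_0)
  qed blast
  then show ?thesis
    by (auto simp: connected_partitions_Suc[OF assms])
qed

text \<open>With no block count to induct on, the induction is over proper subsets. Charging
  \<open>lam\<close> to each block makes it part of the weight in
  \<open>ext_min_sum_insert\<close>.\<close>

lemma penalized_eq:
  assumes "finite S" "S \<subseteq> pverts H"
  shows "penalized H x lam S =
    ext_min ((\<lambda>P. \<Sum>A\<in>P. ereal (sse x A + lam)) ` (\<Union>k. connected_partitions H k S))"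
  using assms
proof (induction S rule: finite_psubset_induct)
  case (psubset S)
  show ?case
  proof (cases "S = {}")
    case True
    have "(\<Union>k. connected_partitions H k {}) = {{}}"
      using UN_connected_partitions[of "{}" 0 H] by (simp add: connected_partitions_empty)
    with True show ?thesis by (simp add: penalized_empty ext_min_def)
  next
    case False
    let ?M = "\<lambda>S. ext_min ((\<lambda>P. \<Sum>A\<in>P. ereal (sse x A + lam)) ` (\<Union>k. connected_partitions H k S))"
    have "penalized H x lam S = ext_min
        ((\<lambda>B. ereal (sse x B) + ereal lam + penalized H x lam (S - B)) ` penalized_blocks H S)"
      using psubset.hyps False by (rule penalized_rec)
    also have "\<dots> = ext_min ((\<lambda>B. ereal (sse x B + lam) + ?M (S - B)) ` penalized_blocks H S)"
    proof (intro arg_cong[where f = ext_min] image_cong refl)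
      fix B assume "B \<in> penalized_blocks H S"
      \<comment> \<open>Strict because \<open>B\<close> contains \<open>Min S\<close>, an element of
        \<open>S\<close>.\<close>
      then have "S - B \<subset> S" by (auto simp: penalized_blocks_def connected_sets_def)
      with psubset.prems have "penalized H x lam (S - B) = ?M (S - B)"
        by (intro psubset.IH) auto
      then show "ereal (sse x B) + ereal lam + penalized H x lam (S - B) =
          ereal (sse x B + lam) + ?M (S - B)"
        by simp
    qed
    also have "\<dots> = ?M S"
      unfolding UN_connected_partitions_rec[OF psubset.hyps False psubset.prems]
    proof (rule ext_min_sum_insert[symmetric])
      show "finite (penalized_blocks H S)" by (rule finite_penalized_blocks[OF psubset.hyps])
      show "finite (\<Union>k. connected_partitions H k (S - B))" for B
        \<comment> \<open>Back to finitely many values of \<open>k\<close>, each with finitely many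
          partitions.\<close>
        unfolding UN_connected_partitions[OF finite_Diff[OF psubset.hyps] order_refl, symmetric]
        using psubset.hyps finite_connected_partitions by blast
      show "finite P \<and> B \<notin> P"
        if "B \<in> penalized_blocks H S" "P \<in> (\<Union>k. connected_partitions H k (S - B))" for B P
        using that psubset.hyps penalized_block_notin_partition by blast
    qed
    finally show ?thesis .
  qed
qed

theorem theorem1:
  fixes n :: nat
    and H :: "nat pair_pre_digraph"
    and x :: "nat \<Rightarrow> real ^ 'd"
    and lam :: real
  assumes "pair_graph H"
    and "pverts H = {1..n}"
    and "lam > 0"
  shows "(\<forall>S k. S \<subseteq> {1..n} \<longrightarrow>
            fixed_count H x S k =
              ext_min ((\<lambda>P. \<Sum>A\<in>P. ereal (sse x A)) ` connected_partitions H k S))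
       \<and> (\<forall>S. S \<subseteq> {1..n} \<longrightarrow>
            penalized H x lam S =
              ext_min ((\<lambda>P. \<Sum>A\<in>P. (ereal (sse x A) + ereal lam)) `
                (\<Union>k\<in>{0..card S}. connected_partitions H k S)))
       \<and> (\<forall>K. 1 \<le> K \<and> K \<le> n \<longrightarrow> fixed_count H x {1..n} K = OPT H x K)"
proof -
  have fin: "finite S" "S \<subseteq> pverts H" if "S \<subseteq> {1..n}" for S
    using that assms(2) finite_subset by auto
  have "penalized H x lam S = ext_min ((\<lambda>P. \<Sum>A\<in>P. (ereal (sse x A) + ereal lam)) `
      (\<Union>k\<in>{0..card S}. connected_partitions H k S))" if "S \<subseteq> {1..n}" for S
    \<comment> \<open>\<open>plus_ereal.simps\<close> merges the two \<open>ereal\<close> summands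
      into the weight used in \<open>penalized_eq\<close>.\<close>
    unfolding UN_connected_partitions[OF fin(1)[OF that] order_refl] plus_ereal.simps
    by (rule penalized_eq[OF fin[OF that]])
  moreover have "fixed_count H x S k =
      ext_min ((\<lambda>P. \<Sum>A\<in>P. ereal (sse x A)) ` connected_partitions H k S)" if "S \<subseteq> {1..n}" for S k
    by (rule fixed_count_eq[OF fin[OF that]])
  \<comment> \<open>The claim on \<open>OPT\<close> is the fixed-count identity at the whole vertex
    set.\<close>
  ultimately show ?thesis
    unfolding OPT_def assms(2) by blast
qed

end
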